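(* Let $1\le p<\infty$, let $X,Y$ be real Banach spaces, let $U\subseteq X$ be an open convex subset and let $f\in C^{1u}(U,Y)$. Then the following assertions are equivalent: (i) $f\in C^{p}_{wsc}(U,Y)$; (ii) for every $U$-bounded weakly $p$-Cauchy sequence $(x_n)_n$ in $U$ and every weakly $p$-Cauchy sequence $(h_n)_n\subset X$, the sequence $(f'(x_n)(h_n))_n$ norm converges in $Y$; (iii) for every $U$-bounded weakly $p$-Cauchy sequence $(x_n)_n$ in $U$ and every weakly $p$-summable sequence $(h_n)_n\subset X$, $\lim_{n}\sup_{m}\|f'(x_m)(h_n)\|=0$; (iv) for every $U$-bounded weakly $p$-Cauchy sequence $(x_n)_n$ in $U$ and every weakly $p$-summable sequence $(h_n)_n\subset X$, $\lim_{n}f'(x_n)(h_n)=0$; (v) $f'$ takes $U$-bounded weakly $p$-precompact subsets of $U$ into uniformly $p$-convergent subsets of $L(X,Y)$.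
   Context: $L(X,Y)$ is the space of bounded linear operators from $X$ to $Y$ with the operator norm. A subset $B\subset U$ is $U$-bounded if it is bounded and its distance to the boundary of $U$ is strictly positive (the latter is vacuous if $U=X$); a sequence in $U$ is $U$-bounded if its set of terms is. $C^{1u}(U,Y)$ is the space of (Fréchet) differentiable maps $f:U\to Y$ whose derivative $f':U\to L(X,Y)$ is uniformly continuous on $U$-bounded subsets of $U$. A sequence $(x_n)$ in $X$ is weakly $p$-summable if $(x^*(x_n))_n\in\ell_p$ for every $x^*\in X^*$. It is weakly $p$-Cauchy if $(x_{m_k}-x_{n_k})_k$ is weakly $p$-summable for all strictly increasing sequences $(m_k)$, $(n_k)$ of positive integers. A subset of $X$ is weakly $p$-precompact if every sequence in it has a weakly $p$-Cauchy subsequence. $C^{p}_{wsc}(U,Y)$ is the space of weakly $p$-sequentially continuous maps $f:U\to Y$, i.e. those taking $U$-bounded weakly $p$-Cauchy sequences in $U$ to norm convergent sequences in $Y$. A set $K\subset L(X,Y)$ is uniformly $p$-convergent if $\lim_n\sup_{T\in K}\|T(x_n)\|=0$ for every weakly $p$-summable sequence $(x_n)$ in $X$. *)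

theory Defs
  imports "HOL-Analysis.Analysis"
begin

text \<open>
  Maps on an open set \<open>U\<close> are total functions, of which only the values on \<open>U\<close> matter.
  The dual of \<open>'a\<close> is \<open>'a \<Rightarrow>\<^sub>L real\<close>; sequences are indexed from 0.
\<close>

text \<open>
  The library sets \<open>setdist A B = 0\<close> if \<open>A\<close> or \<open>B\<close> is empty, whereas here such a
  distance counts as \<open>\<infinity>\<close>; hence the two extra disjuncts.
\<close>

definition U_bounded :: "'a::real_normed_vector set \<Rightarrow> 'a set \<Rightarrow> bool" where
  "U_bounded U B \<longleftrightarrow> B \<subseteq> U \<and> bounded B \<and>
     (frontier U = {} \<or> B = {} \<or> setdist B (frontier U) > 0)"

text \<open>
  The Frechet derivative as an element of \<open>L(X,Y)\<close>; meaningful only where \<open>f\<close> is differentiable.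
\<close>

definition fderiv ::
  "('a::real_normed_vector \<Rightarrow> 'b::real_normed_vector) \<Rightarrow> 'a \<Rightarrow> 'a \<Rightarrow>\<^sub>L 'b" where
  "fderiv f x = Blinfun (frechet_derivative f (at x))"

definition C1u :: "'a::real_normed_vector set \<Rightarrow> ('a \<Rightarrow> 'b::real_normed_vector) set" where
  "C1u U = {f. (\<forall>x\<in>U. f differentiable (at x)) \<and>
               (\<forall>B. U_bounded U B \<longrightarrow> uniformly_continuous_on B (fderiv f))}"

definition weakly_p_summable :: "real \<Rightarrow> (nat \<Rightarrow> 'a::real_normed_vector) \<Rightarrow> bool" where
  "weakly_p_summable p x \<longleftrightarrow>
     (\<forall>\<phi> :: 'a \<Rightarrow>\<^sub>L real. summable (\<lambda>n. \<bar>blinfun_apply \<phi> (x n)\<bar> powr p))"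

definition weakly_p_Cauchy :: "real \<Rightarrow> (nat \<Rightarrow> 'a::real_normed_vector) \<Rightarrow> bool" where
  "weakly_p_Cauchy p x \<longleftrightarrow>
     (\<forall>m n :: nat \<Rightarrow> nat. strict_mono m \<longrightarrow> strict_mono n \<longrightarrow>
        weakly_p_summable p (\<lambda>k. x (m k) - x (n k)))"

definition weakly_p_precompact :: "real \<Rightarrow> 'a::real_normed_vector set \<Rightarrow> bool" where
  "weakly_p_precompact p A \<longleftrightarrow>
     (\<forall>x :: nat \<Rightarrow> 'a. range x \<subseteq> A \<longrightarrow>
        (\<exists>r :: nat \<Rightarrow> nat. strict_mono r \<and> weakly_p_Cauchy p (x \<circ> r)))"

definition Cp_wsc ::
  "real \<Rightarrow> 'a::real_normed_vector set \<Rightarrow> ('a \<Rightarrow> 'b::real_normed_vector) set" where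
  "Cp_wsc p U = {f. \<forall>x :: nat \<Rightarrow> 'a.
     U_bounded U (range x) \<longrightarrow> weakly_p_Cauchy p x \<longrightarrow> convergent (\<lambda>n. f (x n))}"

text \<open>
  The supremum is taken in \<open>ennreal\<close>, where it is \<open>\<infinity>\<close> for unbounded families and 0 for the
  empty one; over \<open>real\<close> it would be unspecified.
\<close>

definition uniformly_p_convergent ::
  "real \<Rightarrow> ('a::real_normed_vector \<Rightarrow>\<^sub>L 'b::real_normed_vector) set \<Rightarrow> bool" where
  "uniformly_p_convergent p K \<longleftrightarrow>
     (\<forall>x :: nat \<Rightarrow> 'a. weakly_p_summable p x \<longrightarrow>
        (\<lambda>n. SUP T\<in>K. ennreal (norm (blinfun_apply T (x n)))) \<longlonglongrightarrow> 0)"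

end

theory Submission
  imports Defs
begin

text \<open>
  Everything is reduced to (iv). If \<open>f\<close> is weakly \<open>p\<close>-sequentially continuous and \<open>(h\<^sub>n)\<close> is weakly
  \<open>p\<close>-Cauchy, then \<open>(h\<^sub>n)\<close> is norm bounded (Hahn--Banach and uniform boundedness), so for small \<open>t\<close>
  the sequence \<open>(x\<^sub>n + t h\<^sub>n)\<close> stays \<open>U\<close>-bounded and the convergent sequences
  \<open>(f (x\<^sub>n + t h\<^sub>n) - f x\<^sub>n) / t\<close> approximate \<open>f' (x\<^sub>n) h\<^sub>n\<close> uniformly in \<open>n\<close>. Conversely, given (iv),
  the mean value inequality bounds \<open>f (x\<^bsub>m(k)\<^esub>) - f (x\<^bsub>n(k)\<^esub>)\<close> by \<open>f' (z\<^sub>k) (x\<^bsub>m(k)\<^esub> - x\<^bsub>n(k)\<^esub>)\<close> up to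
  \<open>1/(k+1)\<close>, with \<open>z\<^sub>k\<close> on the segment; convexity of \<open>U\<close> keeps \<open>(z\<^sub>k)\<close> \<open>U\<close>-bounded, and it is again
  weakly \<open>p\<close>-Cauchy. The uniform versions (iii) and (v) follow from (iv) by passing to subsequences.
\<close>

subsection \<open>Norming functionals and uniform boundedness\<close>

text \<open>Positive homogeneity is asked only as an inequality, which is less to check for
  \<open>sublinear_shift\<close> and for infima of chains. Equality is recovered in
  \<open>sublinear_scaleR\<close>.\<close>

definition sublinear :: "('a::real_vector \<Rightarrow> real) \<Rightarrow> bool" where
  "sublinear q \<longleftrightarrow> q 0 = 0 \<and> (\<forall>x y. q (x + y) \<le> q x + q y) \<and>
     (\<forall>c>0. \<forall>x. q (c *\<^sub>R x) \<le> c * q x)"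

text \<open>Applying the inequality with factor \<open>1/c\<close> to the vector
  \<open>c *\<^sub>R x\<close> turns it around.\<close>

lemma sublinear_scaleR:
  assumes "sublinear q" "0 \<le> c"
  shows "q (c *\<^sub>R x) = c * q x"
proof (cases "c = 0")
  case False
  then have c: "c > 0" using assms by simp
  have "q ((1/c) *\<^sub>R c *\<^sub>R x) \<le> (1/c) * q (c *\<^sub>R x)"
    using assms(1) c unfolding sublinear_def by (metis zero_less_divide_1_iff)
  then have "c * q x \<le> q (c *\<^sub>R x)" using c by (simp add: field_simps)
  then show ?thesis using assms(1) c unfolding sublinear_def by (meson antisym)
qed (use assms in \<open>simp add: sublinear_def\<close>)

lemma sublinear_minus_le:
  assumes "sublinear q"
  shows "- q (- x) \<le> q x"
proof -
  have "q (x + - x) \<le> q x + q (- x)" "q 0 = 0"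
    using assms unfolding sublinear_def by blast+
  then show ?thesis by simp
qed

lemma sublinear_norm: "sublinear (norm :: 'a::real_normed_vector \<Rightarrow> real)"
  by (simp add: sublinear_def norm_triangle_ineq)

text \<open>
  Shifting does not increase \<open>q\<close>, so a minimal sublinear functional equals all its shifts,
  which forces it to be additive; this replaces the usual extension argument for Hahn--Banach.
\<close>

definition sublinear_shift :: "('a::real_vector \<Rightarrow> real) \<Rightarrow> 'a \<Rightarrow> 'a \<Rightarrow> real" where
  "sublinear_shift q x y = (INF t\<in>{0..}. q (y + t *\<^sub>R x) - t * q x)"

context
  fixes q :: "'a::real_vector \<Rightarrow> real"
  assumes q: "sublinear q"
begin

lemma sublinear_shift_le:
  assumes "0 \<le> t"
  shows "sublinear_shift q x y \<le> q (y + t *\<^sub>R x) - t * q x"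
  unfolding sublinear_shift_def
proof (rule cINF_lower)
  show "bdd_below ((\<lambda>t. q (y + t *\<^sub>R x) - t * q x) ` {0..})"
  \<comment> \<open>A bound independent of \<open>t\<close>: subadditivity is applied to
    \<open>t *\<^sub>R x\<close>, written as \<open>- y + (y + t *\<^sub>R x)\<close>.\<close>
  proof (rule bdd_belowI2[where m = "- q (- y)"])
    fix t :: real assume "t \<in> {0..}"
    then have "t * q x = q (- y + (y + t *\<^sub>R x))" using sublinear_scaleR[OF q] by simp
    also have "\<dots> \<le> q (- y) + q (y + t *\<^sub>R x)" using q unfolding sublinear_def by blast
    finally show "- q (- y) \<le> q (y + t *\<^sub>R x) - t * q x" by simp
  qed
qed (use assms in auto)

lemma le_sublinear_shiftI:
  assumes "\<And>t. 0 \<le> t \<Longrightarrow> b \<le> q (y + t *\<^sub>R x) - t * q x"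
  shows "b \<le> sublinear_shift q x y"
  unfolding sublinear_shift_def using assms by (intro cINF_greatest) auto

lemma sublinear_shift_le_self: "sublinear_shift q x y \<le> q y"
  using sublinear_shift_le[of 0] by simp

text \<open>Parameters \<open>s\<close> for \<open>y\<close> and \<open>t\<close> for
  \<open>z\<close> combine to \<open>s + t\<close> for \<open>y + z\<close>; scaling
  \<open>y\<close> by \<open>c\<close> corresponds to scaling the parameter by
  \<open>c\<close>.\<close>

lemma sublinear_sublinear_shift: "sublinear (sublinear_shift q x)"
  unfolding sublinear_def
proof (intro conjI allI impI)
  show "sublinear_shift q x 0 = 0"
    unfolding sublinear_shift_def using sublinear_scaleR[OF q] by simp
next
  fix y z
  have *: "sublinear_shift q x (y + z) \<le> (q (y + s *\<^sub>R x) - s * q x) + (q (z + t *\<^sub>R x) - t * q x)"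
    if "0 \<le> s" "0 \<le> t" for s t
  proof -
    have "sublinear_shift q x (y + z) \<le> q (y + z + (s + t) *\<^sub>R x) - (s + t) * q x"
      using that by (intro sublinear_shift_le) simp
    also have "y + z + (s + t) *\<^sub>R x = (y + s *\<^sub>R x) + (z + t *\<^sub>R x)"
      by (simp add: algebra_simps)
    also have "q \<dots> \<le> q (y + s *\<^sub>R x) + q (z + t *\<^sub>R x)"
      using q unfolding sublinear_def by blast
    finally show ?thesis by (simp add: algebra_simps)
  qed
  \<comment> \<open>The infimum is taken over \<open>t\<close> first, with \<open>s\<close> fixed,
    and over \<open>s\<close> afterwards.\<close>
  have "sublinear_shift q x (y + z) - sublinear_shift q x z \<le> q (y + s *\<^sub>R x) - s * q x"
    if "0 \<le> s" for s
  proof -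
    have "sublinear_shift q x (y + z) - (q (y + s *\<^sub>R x) - s * q x) \<le> sublinear_shift q x z"
      using *[OF that] by (intro le_sublinear_shiftI) (simp add: algebra_simps)
    then show ?thesis by simp
  qed
  then have "sublinear_shift q x (y + z) - sublinear_shift q x z \<le> sublinear_shift q x y"
    by (rule le_sublinear_shiftI)
  then show "sublinear_shift q x (y + z) \<le> sublinear_shift q x y + sublinear_shift q x z"
    by simp
next
  fix c :: real and y assume c: "c > 0"
  have "sublinear_shift q x (c *\<^sub>R y) / c \<le> sublinear_shift q x y"
  proof (rule le_sublinear_shiftI)
    fix t :: real assume t: "0 \<le> t"
    have "sublinear_shift q x (c *\<^sub>R y) \<le> q (c *\<^sub>R y + (c * t) *\<^sub>R x) - (c * t) * q x"
      using c t by (intro sublinear_shift_le) simp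
    also have "c *\<^sub>R y + (c * t) *\<^sub>R x = c *\<^sub>R (y + t *\<^sub>R x)" by (simp add: algebra_simps)
    also have "q \<dots> = c * q (y + t *\<^sub>R x)" using sublinear_scaleR[OF q] c by simp
    finally show "sublinear_shift q x (c *\<^sub>R y) / c \<le> q (y + t *\<^sub>R x) - t * q x"
      using c by (simp add: field_simps)
  qed
  then show "sublinear_shift q x (c *\<^sub>R y) \<le> c * sublinear_shift q x y"
    using c by (simp add: field_simps)
qed

end

text \<open>Zorn's lemma: the pointwise infimum of a chain is again sublinear, and it is finite
  because every member is bounded below at \<open>y\<close> by
  \<open>- q\<^sub>0 (- y)\<close>.\<close>

lemma minimal_sublinear_exists:
  fixes q\<^sub>0 :: "'a::real_vector \<Rightarrow> real"
  assumes q0: "sublinear q\<^sub>0"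
  obtains q where "sublinear q" "\<And>y. q y \<le> q\<^sub>0 y"
    "\<And>r. sublinear r \<Longrightarrow> (\<And>y. r y \<le> q y) \<Longrightarrow> r = q"
proof -
  define A where "A = {q. sublinear q \<and> (\<forall>y. q y \<le> q\<^sub>0 y)}"
  \<comment> \<open>The pointwise order reversed, so that a maximal element for \<open>P\<close> is
    a minimal functional.\<close>
  define P :: "('a \<Rightarrow> real) \<Rightarrow> ('a \<Rightarrow> real) \<Rightarrow> bool" where "P a u \<longleftrightarrow> (\<forall>y. u y \<le> a y)" for a u
  have "\<exists>m\<in>A. \<forall>a\<in>A. P m a \<longrightarrow> a = m"
  proof (rule predicate_Zorn)
    show "partial_order_on A (relation_of P A)"
      by (rule partial_order_on_relation_ofI) (auto simp: P_def fun_eq_iff intro: order_trans antisym)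
  next
    fix C assume C: "C \<in> Chains (relation_of P A)"
    \<comment> \<open>Inserting \<open>q\<^sub>0\<close> keeps the infimum over a nonempty set even
      for the empty chain, and puts \<open>u\<close> below \<open>q\<^sub>0\<close>.\<close>
    let ?C = "insert q\<^sub>0 C"
    have CA: "?C \<subseteq> A" using C q0 unfolding Chains_def relation_of_def A_def by auto
    have chain: "P a b \<or> P b a" if "a \<in> ?C" "b \<in> ?C" for a b
      using that C CA unfolding Chains_def relation_of_def by (auto simp: A_def P_def)
    define u where "u y = (INF q\<in>?C. q y)" for y
    have bdd: "bdd_below ((\<lambda>q. q y) ` ?C)" for y
    proof (rule bdd_belowI2[where m = "- q\<^sub>0 (- y)"])
      fix q assume "q \<in> ?C"
      then have "sublinear q" "q (- y) \<le> q\<^sub>0 (- y)" using CA unfolding A_def by auto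
      then show "- q\<^sub>0 (- y) \<le> q y" using sublinear_minus_le[of q y] by linarith
    qed
    have u_le: "u y \<le> q y" if "q \<in> ?C" for q y
      unfolding u_def using bdd that by (rule cINF_lower)
    have le_u: "b \<le> u y" if "\<And>q. q \<in> ?C \<Longrightarrow> b \<le> q y" for b y
      unfolding u_def using that by (intro cINF_greatest) auto
    have sub: "sublinear q" if "q \<in> ?C" for q using that CA unfolding A_def by auto
    have "sublinear u"
      unfolding sublinear_def
    proof (intro conjI allI impI)
      show "u 0 = 0"
      proof (rule antisym)
        show "u 0 \<le> 0" using u_le[of q\<^sub>0 0] q0 by (simp add: sublinear_def)
        show "0 \<le> u 0" by (intro le_u) (metis sub sublinear_def order_refl)
      qed
    next
      fix x y
      have *: "u (x + y) \<le> a x + b y" if ab: "a \<in> ?C" "b \<in> ?C" for a b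
      proof -
        \<comment> \<open>The smaller of \<open>a\<close> and \<open>b\<close> serves at both
          points; this is where the chain property enters.\<close>
        obtain c where c: "c \<in> ?C" "c x \<le> a x" "c y \<le> b y"
          using chain[OF ab] ab unfolding P_def by blast
        have "u (x + y) \<le> c (x + y)" by (rule u_le[OF c(1)])
        also have "\<dots> \<le> c x + c y" using sub[OF c(1)] unfolding sublinear_def by blast
        finally show ?thesis using c by linarith
      qed
      have "u (x + y) - u y \<le> a x" if "a \<in> ?C" for a
      proof -
        have "u (x + y) - a x \<le> u y"
          by (rule le_u) (use *[OF that] in \<open>simp add: algebra_simps\<close>)
        then show ?thesis by simp
      qed
      then have "u (x + y) - u y \<le> u x" by (rule le_u)
      then show "u (x + y) \<le> u x + u y" by simp
    next
      fix c :: real and x assume c: "c > 0"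
      have "u (c *\<^sub>R x) / c \<le> u x"
      proof (rule le_u)
        fix q assume qC: "q \<in> ?C"
        have "u (c *\<^sub>R x) \<le> q (c *\<^sub>R x)" by (rule u_le[OF qC])
        also have "\<dots> = c * q x" using sublinear_scaleR[OF sub[OF qC]] c by simp
        finally show "u (c *\<^sub>R x) / c \<le> q x" using c by (simp add: field_simps)
      qed
      then show "u (c *\<^sub>R x) \<le> c * u x" using c by (simp add: field_simps)
    qed
    then have "u \<in> A" using u_le[of q\<^sub>0] by (simp add: A_def)
    then show "\<exists>u\<in>A. \<forall>a\<in>C. P a u" using u_le by (auto simp: P_def)
  qed
  then obtain q where "q \<in> A" "\<And>a. a \<in> A \<Longrightarrow> P q a \<Longrightarrow> a = q" by blast
  then show ?thesis
    by (intro that[of q]) (auto simp: A_def P_def intro: order_trans)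
qed

lemma minimal_sublinear_add:
  assumes q: "sublinear q" and min: "\<And>r. sublinear r \<Longrightarrow> (\<And>y. r y \<le> q y) \<Longrightarrow> r = q"
  shows "q (x + y) = q x + q y"
proof (rule antisym)
  show "q (x + y) \<le> q x + q y" using q unfolding sublinear_def by blast
  have "sublinear_shift q x = q"
    by (intro min sublinear_sublinear_shift sublinear_shift_le_self q)
  \<comment> \<open>The parameter value 1 in the infimum gives
    \<open>q y \<le> q (y + x) - q x\<close>.\<close>
  then show "q x + q y \<le> q (x + y)"
    using sublinear_shift_le[OF q, of 1 x y] by (simp add: algebra_simps)
qed

text \<open>The minimal functional is taken below the shift of the norm along \<open>x\<close>, not
  below the norm itself: parameter 1 bounds the shift at \<open>- x\<close> by
  \<open>- norm x\<close>, and linearity then forces the value \<open>norm x\<close> at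
  \<open>x\<close>.\<close>

theorem norming_functional_exists:
  fixes x :: "'a::real_normed_vector"
  obtains \<phi> :: "'a \<Rightarrow>\<^sub>L real" where "norm \<phi> \<le> 1" "blinfun_apply \<phi> x = norm x"
proof -
  define q\<^sub>0 where "q\<^sub>0 = sublinear_shift norm x"
  have q0: "sublinear q\<^sub>0" unfolding q\<^sub>0_def by (intro sublinear_sublinear_shift sublinear_norm)
  have q0_le: "q\<^sub>0 y \<le> norm y" for y
    unfolding q\<^sub>0_def by (intro sublinear_shift_le_self sublinear_norm)
  have q0_x: "q\<^sub>0 (- x) \<le> - norm x"
    unfolding q\<^sub>0_def using sublinear_shift_le[OF sublinear_norm, of 1 x "- x"] by simp
  obtain q where q: "sublinear q" and qq0: "\<And>y. q y \<le> q\<^sub>0 y"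
    and min: "\<And>r. sublinear r \<Longrightarrow> (\<And>y. r y \<le> q y) \<Longrightarrow> r = q"
    using minimal_sublinear_exists[OF q0] by blast
  have add: "q (y + z) = q y + q z" for y z by (rule minimal_sublinear_add[OF q min])
  have neg: "q (- y) = - q y" for y
    using add[of y "- y"] q by (simp add: sublinear_def)
  have "q (c *\<^sub>R y) = c * q y" for c y
    using sublinear_scaleR[OF q, of c y] sublinear_scaleR[OF q, of "- c" y] neg[of "c *\<^sub>R y"]
    by (cases "0 \<le> c") auto
  moreover have bound: "\<bar>q y\<bar> \<le> norm y" for y
    using qq0[of y] qq0[of "- y"] q0_le[of y] q0_le[of "- y"] neg[of y] by simp
  ultimately have bl: "bounded_linear q"
    using add by (intro bounded_linear_intro[where K = 1]) auto
  show ?thesis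
  proof (rule that[of "Blinfun q"])
    show "norm (Blinfun q) \<le> 1"
      using bound by (intro norm_blinfun_bound) (auto simp: bounded_linear_Blinfun_apply[OF bl])
    show "blinfun_apply (Blinfun q) x = norm x"
      using bound[of x] qq0[of "- x"] q0_x neg[of x]
      by (simp add: bounded_linear_Blinfun_apply[OF bl])
  qed
qed

text \<open>Baire category in the dual, which is complete: it is the union of the closed sets
  \<open>B k\<close> of functionals bounded by \<open>k\<close> along \<open>h\<close>, so some
  \<open>B k\<close> contains a ball.\<close>

theorem weakly_bounded_imp_bounded:
  fixes h :: "nat \<Rightarrow> 'a::real_normed_vector"
  assumes "\<And>\<phi> :: 'a \<Rightarrow>\<^sub>L real. Bseq (\<lambda>n. blinfun_apply \<phi> (h n))"
  shows "bounded (range h)"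
proof -
  define B where "B k = {\<phi> :: 'a \<Rightarrow>\<^sub>L real. \<forall>n. \<bar>blinfun_apply \<phi> (h n)\<bar> \<le> real k}" for k :: nat
  have "\<phi> \<in> (\<Union>k. B k)" for \<phi>
  proof -
    obtain K where K: "\<And>n. norm (blinfun_apply \<phi> (h n)) \<le> K"
      using assms[of \<phi>] unfolding Bseq_def by blast
    obtain k :: nat where "K \<le> real k" using real_arch_simple by blast
    then have "\<phi> \<in> B k" using K unfolding B_def by (force intro: order_trans)
    then show ?thesis by blast
  qed
  then have U: "\<Union>(range B) = UNIV" by blast
  have closed: "closed (B k)" for k
    unfolding B_def
    by (intro closed_Collect_all closed_Collect_le continuous_intros)
  have "\<exists>k. interior (B k) \<noteq> {}"
  proof (rule ccontr)
    assume "\<not> ?thesis"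
    then have "Met_TC.mtopology interior_of \<Union>(range B) = {}"
      using closed by (intro Met_TC.metric_Baire_category_alt) (auto simp: complete_UNIV)
    then show False using U by simp
  qed
  then obtain k \<phi> e where e: "e > 0" "cball \<phi> e \<subseteq> B k"
    by (auto simp: mem_interior_cball)
  have "norm (h n) \<le> 2 * real k / e" for n
  proof -
    obtain \<psi> :: "'a \<Rightarrow>\<^sub>L real" where \<psi>: "norm \<psi> \<le> 1" "blinfun_apply \<psi> (h n) = norm (h n)"
      by (rule norming_functional_exists)
    \<comment> \<open>Both functionals are bounded by \<open>k\<close> at \<open>h n\<close>, and
      they differ there by \<open>e * norm (h n)\<close>.\<close>
    have "\<phi> \<in> B k" "\<phi> + e *\<^sub>R \<psi> \<in> B k"
      using e \<psi> by (auto simp: dist_norm intro!: subsetD[OF e(2)])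
    then have "\<bar>blinfun_apply \<phi> (h n)\<bar> \<le> k" "\<bar>blinfun_apply \<phi> (h n) + e * norm (h n)\<bar> \<le> k"
      using \<psi> unfolding B_def by (auto simp: blinfun.add_left blinfun.scaleR_left) metis
    then have "e * norm (h n) \<le> 2 * real k" by linarith
    then show ?thesis using e by (simp add: field_simps)
  qed
  then show ?thesis by (intro boundedI) auto
qed

subsection \<open>Weakly summable and weakly Cauchy sequences\<close>

text \<open>The crude bound of \<open>\<bar>a + b\<bar>\<close> by twice the maximum replaces
  Minkowski's inequality.\<close>

lemma weakly_p_summable_add:
  assumes "0 \<le> p" "weakly_p_summable p x" "weakly_p_summable p y"
  shows "weakly_p_summable p (\<lambda>n. x n + y n)"
  unfolding weakly_p_summable_def
proof
  fix \<phi> :: "'a \<Rightarrow>\<^sub>L real"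
  let ?a = "\<lambda>n. \<bar>blinfun_apply \<phi> (x n)\<bar>" and ?b = "\<lambda>n. \<bar>blinfun_apply \<phi> (y n)\<bar>"
  have "summable (\<lambda>n. 2 powr p * (?a n powr p + ?b n powr p))"
    using assms unfolding weakly_p_summable_def by (intro summable_mult summable_add) auto
  then show "summable (\<lambda>n. \<bar>blinfun_apply \<phi> (x n + y n)\<bar> powr p)"
  proof (rule summable_comparison_test'[where N = 0])
    fix n
    have "\<bar>blinfun_apply \<phi> (x n + y n)\<bar> powr p \<le> (2 * max (?a n) (?b n)) powr p"
      using assms(1) by (intro powr_mono2) (auto simp: blinfun.add_right)
    also have "\<dots> = 2 powr p * max (?a n) (?b n) powr p" by (simp add: powr_mult)
    also have "\<dots> \<le> 2 powr p * (?a n powr p + ?b n powr p)"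
      by (intro mult_left_mono) (auto simp: max_def)
    finally show "norm (\<bar>blinfun_apply \<phi> (x n + y n)\<bar> powr p) \<le> 2 powr p * (?a n powr p + ?b n powr p)"
      by simp
  qed
qed

text \<open>The scalars may vary with the index: later they are the positions of points on segments,
  or 0 and 1 to delete terms.\<close>

lemma weakly_p_summable_scaleR:
  assumes "0 \<le> p" "weakly_p_summable p x" "\<And>n. \<bar>c n\<bar> \<le> C"
  shows "weakly_p_summable p (\<lambda>n. c n *\<^sub>R x n)"
  unfolding weakly_p_summable_def
proof
  fix \<phi> :: "'a \<Rightarrow>\<^sub>L real"
  let ?a = "\<lambda>n. \<bar>blinfun_apply \<phi> (x n)\<bar>"
  have "summable (\<lambda>n. C powr p * ?a n powr p)"
    using assms unfolding weakly_p_summable_def by (intro summable_mult) auto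
  then show "summable (\<lambda>n. \<bar>blinfun_apply \<phi> (c n *\<^sub>R x n)\<bar> powr p)"
  proof (rule summable_comparison_test'[where N = 0])
    fix n
    have "0 \<le> C" using assms(3)[of n] by linarith
    have "\<bar>blinfun_apply \<phi> (c n *\<^sub>R x n)\<bar> powr p \<le> (C * ?a n) powr p"
      using assms(1) assms(3)[of n]
      by (intro powr_mono2) (auto simp: blinfun.scaleR_right abs_mult intro: mult_right_mono)
    also have "\<dots> = C powr p * ?a n powr p" using \<open>0 \<le> C\<close> by (simp add: powr_mult)
    finally show "norm (\<bar>blinfun_apply \<phi> (c n *\<^sub>R x n)\<bar> powr p) \<le> C powr p * ?a n powr p"
      by simp
  qed
qed

lemma weakly_p_summable_subseq:
  assumes "weakly_p_summable p x" "strict_mono r"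
  shows "weakly_p_summable p (\<lambda>n. x (r n))"
  unfolding weakly_p_summable_def
proof
  fix \<phi> :: "'a \<Rightarrow>\<^sub>L real"
  have "summable ((\<lambda>n. \<bar>blinfun_apply \<phi> (x n)\<bar> powr p) \<circ> r)"
    using assms unfolding weakly_p_summable_def
    by (intro summable_reindex strict_mono_imp_inj_on) auto
  then show "summable (\<lambda>n. \<bar>blinfun_apply \<phi> (x (r n))\<bar> powr p)" by (simp add: o_def)
qed

lemma weakly_p_summable_diff:
  assumes "0 \<le> p" "weakly_p_summable p x" "weakly_p_summable p y"
  shows "weakly_p_summable p (\<lambda>n. x n - y n)"
  using weakly_p_summable_add[OF assms(1,2) weakly_p_summable_scaleR[OF assms(1,3), of "\<lambda>_. -1" 1]]
  by simp

lemma weakly_p_summable_imp_Cauchy: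
  assumes "0 \<le> p" "weakly_p_summable p x"
  shows "weakly_p_Cauchy p x"
  unfolding weakly_p_Cauchy_def using assms
  by (auto intro!: weakly_p_summable_diff weakly_p_summable_subseq[OF assms(2)])

lemma weakly_p_Cauchy_const: "weakly_p_Cauchy p (\<lambda>_. c)"
  by (simp add: weakly_p_Cauchy_def weakly_p_summable_def)

lemma weakly_p_Cauchy_subseq:
  assumes "weakly_p_Cauchy p x" "strict_mono r"
  shows "weakly_p_Cauchy p (\<lambda>n. x (r n))"
  unfolding weakly_p_Cauchy_def
proof (intro allI impI)
  fix m n :: "nat \<Rightarrow> nat" assume "strict_mono m" "strict_mono n"
  then have "strict_mono (\<lambda>k. r (m k))" "strict_mono (\<lambda>k. r (n k))"
    using assms(2) by (auto simp: strict_mono_def)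
  then show "weakly_p_summable p (\<lambda>k. x (r (m k)) - x (r (n k)))"
    using assms(1) unfolding weakly_p_Cauchy_def by blast
qed

lemma weakly_p_Cauchy_add:
  assumes "0 \<le> p" "weakly_p_Cauchy p x" "weakly_p_Cauchy p y"
  shows "weakly_p_Cauchy p (\<lambda>n. x n + y n)"
  unfolding weakly_p_Cauchy_def
proof (intro allI impI)
  fix m n :: "nat \<Rightarrow> nat" assume "strict_mono m" "strict_mono n"
  then have "weakly_p_summable p (\<lambda>k. (x (m k) - x (n k)) + (y (m k) - y (n k)))"
    using assms unfolding weakly_p_Cauchy_def by (intro weakly_p_summable_add) auto
  then show "weakly_p_summable p (\<lambda>k. x (m k) + y (m k) - (x (n k) + y (n k)))"
    by (simp add: algebra_simps)
qed

lemma weakly_p_Cauchy_scaleR: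
  assumes "0 \<le> p" "weakly_p_Cauchy p x"
  shows "weakly_p_Cauchy p (\<lambda>n. c *\<^sub>R x n)"
  unfolding weakly_p_Cauchy_def
proof (intro allI impI)
  fix m n :: "nat \<Rightarrow> nat" assume "strict_mono m" "strict_mono n"
  then have "weakly_p_summable p (\<lambda>k. c *\<^sub>R (x (m k) - x (n k)))"
    using assms unfolding weakly_p_Cauchy_def
    by (intro weakly_p_summable_scaleR[where C = "\<bar>c\<bar>"]) auto
  then show "weakly_p_summable p (\<lambda>k. c *\<^sub>R x (m k) - c *\<^sub>R x (n k))"
    by (simp add: algebra_simps)
qed

text \<open>The criterion has the shape of \<open>weakly_p_Cauchy\<close>, with two independent
  subsequences. If \<open>y\<close> is not Cauchy, pairs of indices at distance at least
  \<open>e\<close> can be found arbitrarily far out.\<close>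

lemma Cauchy_if_subseq_diff_tendsto_0:
  fixes y :: "nat \<Rightarrow> 'a::real_normed_vector"
  assumes "\<And>m n. strict_mono m \<Longrightarrow> strict_mono n \<Longrightarrow> (\<lambda>k. y (m k) - y (n k)) \<longlonglongrightarrow> 0"
  shows "Cauchy y"
proof (rule ccontr)
  assume "\<not> Cauchy y"
  then obtain e where e: "e > 0" "\<And>N. \<exists>m\<ge>N. \<exists>n\<ge>N. e \<le> norm (y m - y n)"
    unfolding Cauchy_iff by (meson linorder_not_le)
  \<comment> \<open>Each new pair is chosen beyond both entries of the previous one, so both
    coordinates increase strictly.\<close>
  have "\<exists>q. \<forall>k. (e \<le> norm (y (fst (q k)) - y (snd (q k)))) \<and>
      (fst (q k) < fst (q (Suc k)) \<and> snd (q k) < snd (q (Suc k)))"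
  proof (rule dependent_nat_choice)
    show "\<exists>q. e \<le> norm (y (fst q) - y (snd q))" using e(2)[of 0] by auto
    fix q :: "nat \<times> nat"
    obtain m n where "m \<ge> Suc (max (fst q) (snd q))" "n \<ge> Suc (max (fst q) (snd q))"
      "e \<le> norm (y m - y n)" using e(2) by blast
    then show "\<exists>q'. e \<le> norm (y (fst q') - y (snd q')) \<and> fst q < fst q' \<and> snd q < snd q'"
      by (intro exI[of _ "(m, n)"]) auto
  qed
  then obtain q where q: "\<And>k. e \<le> norm (y (fst (q k)) - y (snd (q k)))"
    "\<And>k. fst (q k) < fst (q (Suc k))" "\<And>k. snd (q k) < snd (q (Suc k))" by blast
  then have "(\<lambda>k. y (fst (q k)) - y (snd (q k))) \<longlonglongrightarrow> 0"
    by (intro assms) (auto simp: strict_mono_Suc_iff)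
  then obtain k where "norm (y (fst (q k)) - y (snd (q k))) < e"
    using e(1) unfolding LIMSEQ_iff by fastforce
  then show False using q(1)[of k] by simp
qed

text \<open>Terms of a convergent series tend to 0, so each functional maps \<open>h\<close> to a
  Cauchy, hence bounded, scalar sequence; uniform boundedness does the rest.\<close>

lemma weakly_p_Cauchy_imp_bounded:
  fixes h :: "nat \<Rightarrow> 'a::real_normed_vector"
  assumes "0 < p" "weakly_p_Cauchy p h"
  shows "bounded (range h)"
proof (rule weakly_bounded_imp_bounded)
  fix \<phi> :: "'a \<Rightarrow>\<^sub>L real"
  have "Cauchy (\<lambda>n. blinfun_apply \<phi> (h n))"
  proof (rule Cauchy_if_subseq_diff_tendsto_0)
    fix m n :: "nat \<Rightarrow> nat" assume mn: "strict_mono m" "strict_mono n"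
    let ?d = "\<lambda>k. \<bar>blinfun_apply \<phi> (h (m k) - h (n k))\<bar>"
    have "(\<lambda>k. ?d k powr p) \<longlonglongrightarrow> 0"
      using assms(2) mn unfolding weakly_p_Cauchy_def weakly_p_summable_def
      by (intro summable_LIMSEQ_zero) blast
    \<comment> \<open>Taking the \<open>p\<close>-th root, which is where \<open>0 < p\<close> is
      needed.\<close>
    then have "(\<lambda>k. (?d k powr p) powr (1 / p)) \<longlonglongrightarrow> 0 powr (1 / p)"
      using assms(1) by (intro tendsto_powr2) auto
    then have "?d \<longlonglongrightarrow> 0" using assms(1) by (simp add: powr_powr)
    then show "(\<lambda>k. blinfun_apply \<phi> (h (m k)) - blinfun_apply \<phi> (h (n k))) \<longlonglongrightarrow> 0"
      by (simp add: blinfun.diff_right tendsto_rabs_zero_iff)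
  qed
  then show "Bseq (\<lambda>n. blinfun_apply \<phi> (h n))" by (rule Cauchy_Bseq)
qed

text \<open>A sequence in the range is \<open>x\<close> along an arbitrary index map
  \<open>m\<close>. If \<open>m\<close> has finite range, a subsequence is constant; otherwise one
  can pass to a subsequence on which \<open>m\<close> increases strictly.\<close>

lemma weakly_p_precompact_range:
  assumes "weakly_p_Cauchy p x"
  shows "weakly_p_precompact p (range x)"
  unfolding weakly_p_precompact_def
proof (intro allI impI)
  fix y :: "nat \<Rightarrow> 'a" assume "range y \<subseteq> range x"
  then have "\<forall>n. \<exists>m. y n = x m" by blast
  then obtain m where y: "\<And>n. y n = x (m n)" by metis
  show "\<exists>r. strict_mono r \<and> weakly_p_Cauchy p (y \<circ> r)"
  proof (cases "finite (range m)")
    case True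
    then obtain c where "infinite {n. m n = c}"
      using pigeonhole_infinite[of UNIV m] by auto
    then obtain r :: "nat \<Rightarrow> nat" where "strict_mono r" "\<And>n. m (r n) = c"
      using infinite_enumerate by blast
    then show ?thesis using weakly_p_Cauchy_const[of p "x c"] by (auto simp: y o_def)
  next
    case False
    have *: "\<exists>k>N. m k > M" for N M
    proof (rule ccontr)
      assume "\<not> ?thesis"
      then have "range m \<subseteq> m ` {..N} \<union> {..M}" by (force simp: not_less)
      then show False using False by (meson finite_Un finite_atMost finite_imageI finite_subset)
    qed
    \<comment> \<open>\<open>True\<close> fills the place of the invariant in
      \<open>dependent_nat_choice\<close>; only the step relation matters.\<close>
    have "\<exists>r. \<forall>k. True \<and> (r k < r (Suc k) \<and> m (r k) < m (r (Suc k)))"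
      using * by (intro dependent_nat_choice) auto
    then obtain r where "\<forall>k. r k < r (Suc k) \<and> m (r k) < m (r (Suc k))" by blast
    then have "strict_mono r" "strict_mono (\<lambda>k. m (r k))"
      by (auto simp: strict_mono_Suc_iff)
    then show ?thesis using weakly_p_Cauchy_subseq[OF assms] by (auto simp: y o_def)
  qed
qed

subsection \<open>Bounded sets away from the boundary\<close>

text \<open>The working form of the definition, with one radius for all points. A ball centred in
  \<open>U\<close> that leaves \<open>U\<close> is connected and so meets the frontier; conversely,
  frontier points of an open set lie outside it.\<close>

lemma U_bounded_iff:
  fixes U :: "'a::real_normed_vector set"
  assumes "open U"
  shows "U_bounded U B \<longleftrightarrow> bounded B \<and> (\<exists>d>0. \<forall>x\<in>B. ball x d \<subseteq> U)"
proof
  assume B: "U_bounded U B"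
  have sub: "ball x d \<subseteq> U" if "x \<in> B" "\<And>y. y \<in> frontier U \<Longrightarrow> d \<le> dist x y" "0 < d" for x d
  proof (rule ccontr)
    assume "\<not> ball x d \<subseteq> U"
    then have "ball x d - U \<noteq> {}" by blast
    moreover have "x \<in> ball x d \<inter> U" using B that unfolding U_bounded_def by auto
    ultimately have "ball x d \<inter> frontier U \<noteq> {}"
      by (intro connected_Int_frontier convex_connected convex_ball) blast+
    then show False using that(2) by force
  qed
  have "\<exists>d>0. \<forall>x\<in>B. ball x d \<subseteq> U"
  proof (cases "frontier U = {} \<or> B = {}")
    case True
    \<comment> \<open>Without frontier points or without points of \<open>B\<close> any radius
      works; 1 is an arbitrary choice.\<close>
    then show ?thesis using sub[where d = 1] by (intro exI[of _ 1]) auto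
  next
    case False
    then have "setdist B (frontier U) > 0" using B unfolding U_bounded_def by blast
    then show ?thesis
      by (intro exI[of _ "setdist B (frontier U)"] conjI ballI sub) (auto intro: setdist_le_dist)
  qed
  then show "bounded B \<and> (\<exists>d>0. \<forall>x\<in>B. ball x d \<subseteq> U)" using B unfolding U_bounded_def by blast
next
  assume "bounded B \<and> (\<exists>d>0. \<forall>x\<in>B. ball x d \<subseteq> U)"
  then obtain d where B: "bounded B" "d > 0" "\<And>x. x \<in> B \<Longrightarrow> ball x d \<subseteq> U" by blast
  have "setdist B (frontier U) > 0" if "frontier U \<noteq> {}" "B \<noteq> {}"
  proof -
    have "d \<le> setdist B (frontier U)"
    proof (rule le_setdistI)
      fix x y assume "x \<in> B" "y \<in> frontier U"
      moreover have "y \<notin> U" using \<open>y \<in> frontier U\<close> assms by (simp add: frontier_def interior_open)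
      ultimately show "d \<le> dist x y" using B(3)[of x] by (auto simp: subset_eq not_less)
    qed (use that in auto)
    then show ?thesis using B(2) by simp
  qed
  moreover have "B \<subseteq> U" using B by (meson centre_in_ball subset_eq)
  ultimately show "U_bounded U B" using B(1) unfolding U_bounded_def by blast
qed

lemma U_bounded_subset:
  assumes "open U" "U_bounded U B" "C \<subseteq> B"
  shows "U_bounded U C"
  using assms(2,3) bounded_subset[of B C] unfolding U_bounded_iff[OF assms(1)] by blast

text \<open>A point at offset \<open>v\<close> from the intermediate point is the same convex
  combination of \<open>x + v\<close> and \<open>y + v\<close>.\<close>

lemma ball_subset_segment:
  assumes "convex U" "ball x d \<subseteq> U" "ball y d \<subseteq> U" "0 \<le> t" "t \<le> 1"
  shows "ball (x + t *\<^sub>R (y - x)) d \<subseteq> (U :: 'a::real_normed_vector set)"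
proof
  fix w assume w: "w \<in> ball (x + t *\<^sub>R (y - x)) d"
  define v where "v = w - (x + t *\<^sub>R (y - x))"
  have "norm v < d" using w by (simp add: v_def dist_norm norm_minus_commute)
  then have "x + v \<in> U" "y + v \<in> U" using assms(2,3) by (auto simp: subset_eq dist_norm)
  then have "(1 - t) *\<^sub>R (x + v) + t *\<^sub>R (y + v) \<in> U"
    using assms(1,4,5) by (intro convexD) auto
  moreover have "(1 - t) *\<^sub>R (x + v) + t *\<^sub>R (y + v) = w"
    by (simp add: v_def algebra_simps)
  ultimately show "w \<in> U" by simp
qed

text \<open>The radius of \<open>B\<close> survives by convexity of \<open>U\<close>, its norm bound
  by convexity of \<open>cball 0 M\<close>.\<close>

lemma U_bounded_segments:
  fixes U :: "'a::real_normed_vector set"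
  assumes "open U" "convex U" "U_bounded U B"
    "\<And>k::nat. x k \<in> B" "\<And>k. y k \<in> B" "\<And>k. t k \<in> {0..1}"
  shows "U_bounded U (range (\<lambda>k. x k + t k *\<^sub>R (y k - x k)))"
proof -
  obtain d M where d: "d > 0" "\<And>x. x \<in> B \<Longrightarrow> ball x d \<subseteq> U" and M: "\<And>x. x \<in> B \<Longrightarrow> norm x \<le> M"
    using assms(3) unfolding U_bounded_iff[OF assms(1)] bounded_iff by blast
  have "norm (x k + t k *\<^sub>R (y k - x k)) \<le> M" for k
  proof -
    have "x k + t k *\<^sub>R (y k - x k) = (1 - t k) *\<^sub>R x k + t k *\<^sub>R y k" by (simp add: algebra_simps)
    moreover have "\<dots> \<in> cball 0 M"
      using M assms(4,5) assms(6)[of k] by (intro convexD[OF convex_cball]) auto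
    ultimately show ?thesis by simp
  qed
  moreover have "ball (x k + t k *\<^sub>R (y k - x k)) d \<subseteq> U" for k
    using assms d by (intro ball_subset_segment) auto
  ultimately show ?thesis
    unfolding U_bounded_iff[OF assms(1)] bounded_iff using d(1) by blast
qed

text \<open>Half of the radius available for \<open>B\<close> is spent on the perturbation, the
  other half remains as distance to the boundary.\<close>

lemma U_bounded_perturbation:
  fixes U :: "'a::real_normed_vector set"
  assumes "open U" "U_bounded U B"
  obtains d where "d > 0" "U_bounded U {y. \<exists>x\<in>B. dist x y \<le> d}"
proof -
  obtain d M where d: "d > 0" "\<And>x. x \<in> B \<Longrightarrow> ball x d \<subseteq> U" and M: "\<And>x. x \<in> B \<Longrightarrow> norm x \<le> M"
    using assms unfolding U_bounded_iff[OF assms(1)] bounded_iff by blast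
  have "ball y (d / 2) \<subseteq> U \<and> norm y \<le> M + d / 2" if "x \<in> B" "dist x y \<le> d / 2" for x y
  proof
    have "ball y (d / 2) \<subseteq> ball x d"
    proof
      fix z assume "z \<in> ball y (d / 2)"
      then show "z \<in> ball x d" using that(2) dist_triangle[of x z y] by simp
    qed
    then show "ball y (d / 2) \<subseteq> U" using d(2)[OF that(1)] by blast
    show "norm y \<le> M + d / 2"
      using M[OF that(1)] that(2) norm_triangle_sub[of y x]
      by (simp add: dist_norm norm_minus_commute)
  qed
  then have "U_bounded U {y. \<exists>x\<in>B. dist x y \<le> d / 2}"
    unfolding U_bounded_iff[OF assms(1)] bounded_iff
    using d(1) by (intro conjI exI[of _ "M + d / 2"] exI[of _ "d / 2"]) auto
  then show ?thesis using d(1) by (intro that[of "d / 2"]) auto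
qed

subsection \<open>The derivative along weakly Cauchy sequences\<close>

lemma has_derivative_fderiv:
  assumes "f \<in> C1u U" "x \<in> U"
  shows "(f has_derivative blinfun_apply (fderiv f x)) (at x)"
proof -
  have "(f has_derivative frechet_derivative f (at x)) (at x)"
    using assms frechet_derivative_works unfolding C1u_def by blast
  then show ?thesis
    using has_derivative_bounded_linear unfolding fderiv_def
    by (metis bounded_linear_Blinfun_apply)
qed

text \<open>The mean value inequality for \<open>f (a + t *\<^sub>R h) - t *\<^sub>R w\<close> on
  the unit interval. With \<open>w\<close> a derivative at \<open>a\<close> it bounds the
  linearization error, with \<open>w = 0\<close> the increment.\<close>

lemma segment_diff_bound:
  fixes f :: "'a::real_normed_vector \<Rightarrow> 'b::real_normed_vector"
  assumes "\<And>t. t \<in> {0..1} \<Longrightarrow> (f has_derivative D t) (at (a + t *\<^sub>R h))"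
    and "\<And>t. t \<in> {0..1} \<Longrightarrow> norm (D t h - w) \<le> B"
  shows "norm (f (a + h) - f a - w) \<le> B"
proof -
  let ?g = "\<lambda>t. f (a + t *\<^sub>R h) - t *\<^sub>R w"
  have "norm (?g 1 - ?g 0) \<le> B * norm (1 - 0 :: real)"
  proof (rule differentiable_bound)
    fix t :: real assume t: "t \<in> {0..1}"
    have "((\<lambda>t. a + t *\<^sub>R h) has_derivative (\<lambda>s. s *\<^sub>R h)) (at t within {0..1})"
      by (auto intro!: derivative_eq_intros)
    from has_derivative_compose[OF this assms(1)[OF t]]
    show "(?g has_derivative (\<lambda>s. D t (s *\<^sub>R h) - s *\<^sub>R w)) (at t within {0..1})"
      by (auto intro!: derivative_eq_intros)
    interpret bounded_linear "D t" using assms(1)[OF t] by (rule has_derivative_bounded_linear)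
    show "onorm (\<lambda>s. D t (s *\<^sub>R h) - s *\<^sub>R w) \<le> B"
    proof (rule onorm_bound)
      show "0 \<le> B" using assms(2)[OF t] norm_ge_zero order_trans by blast
      fix s :: real
      have "norm (D t (s *\<^sub>R h) - s *\<^sub>R w) = \<bar>s\<bar> * norm (D t h - w)"
        by (simp add: scaleR flip: scaleR_diff_right)
      then show "norm (D t (s *\<^sub>R h) - s *\<^sub>R w) \<le> B * norm s"
        using assms(2)[OF t] by (simp add: mult.commute[of B] mult_left_mono)
    qed
  qed auto
  then show ?thesis by (simp add: algebra_simps)
qed

text \<open>If the suprema do not tend to 0, then infinitely many \<open>n\<close> admit some
  \<open>T\<close> with value above a fixed \<open>e\<close>. The extra subsequence \<open>s\<close>
  leaves room for extraction by precompactness.\<close>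

lemma SUP_tendsto_0I:
  fixes g :: "'t \<Rightarrow> nat \<Rightarrow> real"
  assumes "\<And>(T :: nat \<Rightarrow> 't) r. (\<And>k. T k \<in> K) \<Longrightarrow> strict_mono r \<Longrightarrow>
      \<exists>s. strict_mono s \<and> (\<lambda>k. g (T (s k)) (r (s k))) \<longlonglongrightarrow> 0"
  shows "(\<lambda>n. SUP T\<in>K. ennreal (g T n)) \<longlonglongrightarrow> 0"
proof (rule order_tendstoI)
  fix a :: ennreal assume "0 < a"
  \<comment> \<open>Bounds on all members give only a weak inequality for the supremum, hence an
    intermediate value, which is also finite.\<close>
  then obtain b where b: "0 < b" "b < a" using dense by blast
  then obtain e where e: "b = ennreal e" "e > 0" by (cases b) auto
  have "finite {n. \<exists>T\<in>K. e < g T n}"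
  proof (rule ccontr)
    assume "infinite {n. \<exists>T\<in>K. e < g T n}"
    then obtain r :: "nat \<Rightarrow> nat" where r: "strict_mono r" "\<forall>k. \<exists>T\<in>K. e < g T (r k)"
      using infinite_enumerate by blast
    then obtain T where T: "\<And>k. T k \<in> K" "\<And>k. e < g (T k) (r k)" by metis
    obtain s where "(\<lambda>k. g (T (s k)) (r (s k))) \<longlonglongrightarrow> 0" using assms[of T, OF T(1) r(1)] by blast
    then have "\<forall>\<^sub>F k in sequentially. g (T (s k)) (r (s k)) < e"
      using e(2) by (rule order_tendstoD)
    then show False using T(2) eventually_happens[of _ sequentially] less_asym
      by (metis (no_types, lifting) sequentially_bot)
  qed
  then have "\<forall>\<^sub>F n in sequentially. \<not> (\<exists>T\<in>K. e < g T n)"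
    unfolding cofinite_eq_sequentially[symmetric] eventually_cofinite by simp
  then show "\<forall>\<^sub>F n in sequentially. (SUP T\<in>K. ennreal (g T n)) < a"
  proof eventually_elim
    case (elim n)
    then have "(SUP T\<in>K. ennreal (g T n)) \<le> b" unfolding e by (intro SUP_least ennreal_leI) force
    then show ?case using b by simp
  qed
qed simp

lemma tendsto_0_of_SUP_tendsto_0:
  fixes g :: "'t \<Rightarrow> nat \<Rightarrow> real"
  assumes "(\<lambda>n. SUP T\<in>K. ennreal (g T n)) \<longlonglongrightarrow> 0" "\<And>n. T n \<in> K" "\<And>T n. 0 \<le> g T n"
  shows "(\<lambda>n. g (T n) n) \<longlonglongrightarrow> 0"
proof -
  have "(\<lambda>n. ennreal (g (T n) n)) \<longlonglongrightarrow> 0"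
  proof (rule tendsto_sandwich[OF _ _ tendsto_const assms(1)])
    show "\<forall>\<^sub>F n in sequentially. ennreal (g (T n) n) \<le> (SUP T\<in>K. ennreal (g T n))"
      using assms(2) by (intro always_eventually allI SUP_upper)
  qed auto
  then show ?thesis
    using assms(3) by (subst (asm) ennreal_tendsto_0_iff) auto
qed

text \<open>Closedness of the convergent sequences under uniform approximation, by the triangle
  inequality and completeness.\<close>

lemma convergent_approxI:
  fixes D :: "nat \<Rightarrow> 'b::banach"
  assumes "\<And>e. e > 0 \<Longrightarrow> \<exists>z. convergent z \<and> (\<forall>n. norm (D n - z n) \<le> e)"
  shows "convergent D"
proof -
  have "Cauchy D"
    unfolding Cauchy_iff
  proof (intro allI impI)
    fix e :: real assume e: "0 < e"
    then obtain z where z: "convergent z" "\<And>n. norm (D n - z n) \<le> e / 4"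
      using assms[of "e / 4"] by auto
    then have "Cauchy z" by (simp add: Cauchy_convergent_iff)
    then obtain M where M: "\<And>m n. m \<ge> M \<Longrightarrow> n \<ge> M \<Longrightarrow> norm (z m - z n) < e / 4"
      using e unfolding Cauchy_iff by (meson zero_less_divide_iff zero_less_numeral)
    have "norm (D m - D n) < e" if "m \<ge> M" "n \<ge> M" for m n
    proof -
      have "D m - D n = (D m - z m) + (z m - z n) - (D n - z n)" by simp
      also have "norm \<dots> \<le> norm (D m - z m) + norm (z m - z n) + norm (D n - z n)"
        by (metis norm_triangle_ineq norm_triangle_ineq4 add_right_mono order_trans)
      also have "\<dots> < e" using z(2)[of m] z(2)[of n] M[OF that] e by linarith
      finally show ?thesis .
    qed
    then show "\<exists>M. \<forall>m\<ge>M. \<forall>n\<ge>M. norm (D m - D n) < e" by blast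
  qed
  then show ?thesis by (rule Cauchy_convergent)
qed

text \<open>The slack \<open>e\<close> buys an actual point on the segment: were every derivative
  value smaller, \<open>segment_diff_bound\<close> with \<open>w = 0\<close> would bound the
  increment by itself minus \<open>e\<close>.\<close>

lemma segment_value_bound:
  fixes f :: "'a::real_normed_vector \<Rightarrow> 'b::real_normed_vector"
  assumes "\<And>t. t \<in> {0..1} \<Longrightarrow> (f has_derivative D t) (at (a + t *\<^sub>R h))" "0 < e"
  shows "\<exists>t\<in>{0..1}. norm (f (a + h) - f a) \<le> norm (D t h) + e"
proof (rule ccontr)
  assume *: "\<not> ?thesis"
  have "norm (D s h - 0) \<le> norm (f (a + h) - f a) - e" if "s \<in> {0..1}" for s
  proof -
    have "\<not> norm (f (a + h) - f a) \<le> norm (D s h) + e"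
      using * that by blast
    then show ?thesis by simp
  qed
  with assms(1) have "norm (f (a + h) - f a - 0) \<le> norm (f (a + h) - f a) - e"
    by (rule segment_diff_bound)
  then show False using assms(2) by simp
qed

section \<open>The implications between the five assertions\<close>

lemma Cp_wsc_imp_fderiv_convergent:
  fixes f :: "'a::banach \<Rightarrow> 'b::banach"
  assumes p: "0 < p" and U: "open U" and f: "f \<in> C1u U" "f \<in> Cp_wsc p U"
    and x: "U_bounded U (range x)" "weakly_p_Cauchy p x" and h: "weakly_p_Cauchy p h"
  shows "convergent (\<lambda>n. blinfun_apply (fderiv f (x n)) (h n))"
proof (rule convergent_approxI)
  fix e :: real assume e: "0 < e"
  obtain d where d: "d > 0" and B: "U_bounded U {y. \<exists>x\<in>range x. dist x y \<le> d}" (is "U_bounded U ?B")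
    using U_bounded_perturbation[OF U x(1)] by blast
  obtain M where M: "M > 0" "\<And>n. norm (h n) \<le> M"
    using weakly_p_Cauchy_imp_bounded[OF p h] unfolding bounded_pos by auto
  have "uniformly_continuous_on ?B (fderiv f)" using f(1) B unfolding C1u_def by blast
  moreover have "e / M > 0" using e M(1) by simp
  ultimately obtain r where r: "r > 0"
    "\<And>y z. y \<in> ?B \<Longrightarrow> z \<in> ?B \<Longrightarrow> dist z y < r \<Longrightarrow> dist (fderiv f z) (fderiv f y) < e / M"
    by (rule uniformly_continuous_onE) (simp only:)
  \<comment> \<open>Displacements have norm at most \<open>t * M = min d (r / 2)\<close>: the
    segments stay in \<open>?B\<close>, and the halving makes the distance strictly less than
    \<open>r\<close>.\<close>
  define t where "t = min d (r / 2) / M"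
  have t: "t > 0" "t * M \<le> d" "t * M < r" using d r M(1) by (auto simp: t_def min_def)
  have near: "norm (s *\<^sub>R t *\<^sub>R h n) \<le> t * M" if "s \<in> {0..1}" for s n
  proof -
    have "norm (s *\<^sub>R t *\<^sub>R h n) = s * (t * norm (h n))" using that t by simp
    also have "\<dots> \<le> 1 * (t * M)" using that t M by (intro mult_mono) auto
    finally show ?thesis by simp
  qed
  have inB: "x n + s *\<^sub>R t *\<^sub>R h n \<in> ?B" if "s \<in> {0..1}" for s n
    using near[OF that, of n] t(2) by (auto simp: dist_norm intro!: exI[of _ n])
  have BU: "?B \<subseteq> U" using B unfolding U_bounded_def by (rule conjunct1)
  define z where "z n = (1 / t) *\<^sub>R (f (x n + t *\<^sub>R h n) - f (x n))" for n
  have "range (\<lambda>n. x n + t *\<^sub>R h n) \<subseteq> ?B" using inB[of 1] by force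
  then have "U_bounded U (range (\<lambda>n. x n + t *\<^sub>R h n))" by (rule U_bounded_subset[OF U B])
  moreover have "weakly_p_Cauchy p (\<lambda>n. x n + t *\<^sub>R h n)"
    using p x h by (intro weakly_p_Cauchy_add weakly_p_Cauchy_scaleR) auto
  ultimately have "convergent (\<lambda>n. f (x n + t *\<^sub>R h n))" "convergent (\<lambda>n. f (x n))"
    using f(2) x unfolding Cp_wsc_def by blast+
  then have "convergent (\<lambda>n. f (x n + t *\<^sub>R h n) - f (x n))" by (rule convergent_diff)
  then obtain l where "(\<lambda>n. f (x n + t *\<^sub>R h n) - f (x n)) \<longlonglongrightarrow> l" unfolding convergent_def by blast
  then have "convergent z"
    unfolding z_def by (rule convergentI[OF tendsto_scaleR[OF tendsto_const]])
  moreover have "norm (blinfun_apply (fderiv f (x n)) (h n) - z n) \<le> e" for n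
  proof -
    let ?L = "fderiv f (x n)"
    \<comment> \<open>The derivative varies by at most \<open>e / M\<close> along the segment and
      the increment has norm at most \<open>t * M\<close>; dividing by \<open>t\<close> leaves
      \<open>e\<close>, uniformly in \<open>n\<close>.\<close>
    have "norm (f (x n + t *\<^sub>R h n) - f (x n) - blinfun_apply ?L (t *\<^sub>R h n)) \<le> t * e"
    proof (rule segment_diff_bound[where f = f and a = "x n" and h = "t *\<^sub>R h n"
          and D = "\<lambda>s. blinfun_apply (fderiv f (x n + s *\<^sub>R t *\<^sub>R h n))"])
      fix s :: real assume s: "s \<in> {0..1}"
      have "x n + s *\<^sub>R t *\<^sub>R h n \<in> U" by (rule subsetD[OF BU inB[OF s]])
      then show "(f has_derivative blinfun_apply (fderiv f (x n + s *\<^sub>R t *\<^sub>R h n)))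
          (at (x n + s *\<^sub>R t *\<^sub>R h n))"
        by (rule has_derivative_fderiv[OF f(1)])
      have "norm (fderiv f (x n + s *\<^sub>R t *\<^sub>R h n) - ?L) \<le> e / M"
        using r(2)[of "x n" "x n + s *\<^sub>R t *\<^sub>R h n"] inB[of 0 n] inB[OF s, of n] near[OF s, of n] t(3)
        by (simp add: dist_norm)
      moreover have "norm (t *\<^sub>R h n) \<le> t * M" using near[of 1 n] by simp
      ultimately have "norm (blinfun_apply (fderiv f (x n + s *\<^sub>R t *\<^sub>R h n) - ?L) (t *\<^sub>R h n))
          \<le> e / M * (t * M)"
        by (intro order_trans[OF norm_blinfun] mult_mono) (use e M in auto)
      then show "norm (blinfun_apply (fderiv f (x n + s *\<^sub>R t *\<^sub>R h n)) (t *\<^sub>R h n) -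
          blinfun_apply ?L (t *\<^sub>R h n)) \<le> t * e"
        using M(1) by (simp add: blinfun.diff_left mult.commute)
    qed
    also have "f (x n + t *\<^sub>R h n) - f (x n) - blinfun_apply ?L (t *\<^sub>R h n) =
        t *\<^sub>R (z n - blinfun_apply ?L (h n))"
      using t(1) by (simp add: z_def blinfun.scaleR_right scaleR_diff_right)
    finally show ?thesis using t(1) by (simp add: norm_minus_commute)
  qed
  ultimately show "\<exists>z. convergent z \<and> (\<forall>n. norm (blinfun_apply (fderiv f (x n)) (h n) - z n) \<le> e)"
    by blast
qed

lemma convergent_imp_tendsto_0_summable:
  fixes T :: "nat \<Rightarrow> 'a::real_normed_vector \<Rightarrow>\<^sub>L 'b::real_normed_vector"
  assumes p: "0 \<le> p" and h: "weakly_p_summable p h"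
    and T: "\<And>h. weakly_p_Cauchy p h \<Longrightarrow> convergent (\<lambda>n. blinfun_apply (T n) (h n))"
  shows "(\<lambda>n. blinfun_apply (T n) (h n)) \<longlonglongrightarrow> 0"
proof -
  \<comment> \<open>Killing the terms of odd index leaves a weakly summable sequence, so the limit is 0.\<close>
  define g where "g n = (if even n then 1 else 0 :: real) *\<^sub>R h n" for n
  have "weakly_p_Cauchy p g"
    unfolding g_def
    by (intro weakly_p_summable_imp_Cauchy weakly_p_summable_scaleR[where C = 1] p h) auto
  then obtain l where l: "(\<lambda>n. blinfun_apply (T n) (g n)) \<longlonglongrightarrow> l" using T unfolding convergent_def by blast
  obtain l' where l': "(\<lambda>n. blinfun_apply (T n) (h n)) \<longlonglongrightarrow> l'"
    using T weakly_p_summable_imp_Cauchy[OF p h] unfolding convergent_def by blast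
  have even: "strict_mono (\<lambda>n::nat. 2 * n)" and odd: "strict_mono (\<lambda>n::nat. 2 * n + 1)"
    by (auto simp: strict_mono_def)
  have "l = 0" using LIMSEQ_subseq_LIMSEQ[OF l odd] by (simp add: g_def o_def LIMSEQ_const_iff)
  moreover have "l = l'"
    using LIMSEQ_subseq_LIMSEQ[OF l even] LIMSEQ_subseq_LIMSEQ[OF l' even]
    by (auto simp: g_def o_def intro: LIMSEQ_unique)
  ultimately show ?thesis using l' by simp
qed

lemma fderiv_null_imp_Cp_wsc:
  fixes f :: "'a::banach \<Rightarrow> 'b::banach"
  assumes p: "0 \<le> p" and U: "open U" "convex U" and f: "f \<in> C1u U"
    and null: "\<And>x h. U_bounded U (range x) \<Longrightarrow> weakly_p_Cauchy p x \<Longrightarrow> weakly_p_summable p h \<Longrightarrow>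
      (\<lambda>n. blinfun_apply (fderiv f (x n)) (h n)) \<longlonglongrightarrow> 0"
  shows "f \<in> Cp_wsc p U"
  unfolding Cp_wsc_def
proof (intro CollectI allI impI)
  fix x :: "nat \<Rightarrow> 'a" assume x: "U_bounded U (range x)" "weakly_p_Cauchy p x"
  have "Cauchy (\<lambda>n. f (x n))"
  proof (rule Cauchy_if_subseq_diff_tendsto_0)
    fix m n :: "nat \<Rightarrow> nat" assume mn: "strict_mono m" "strict_mono n"
    define h where "h k = x (m k) - x (n k)" for k
    have h: "weakly_p_summable p h" using x(2) mn unfolding h_def weakly_p_Cauchy_def by blast
    have seg: "U_bounded U (range (\<lambda>k. x (n k) + t k *\<^sub>R h k))" if "\<And>k. t k \<in> {0..1}" for t
      unfolding h_def using that by (intro U_bounded_segments[OF U x(1)]) auto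
    \<comment> \<open>The slack in the mean value bound is \<open>inverse (real (Suc k))\<close>, so
      that it vanishes in the limit.\<close>
    have "\<exists>t\<in>{0..1}. norm (f (x (m k)) - f (x (n k)))
        \<le> norm (blinfun_apply (fderiv f (x (n k) + t *\<^sub>R h k)) (h k)) + inverse (real (Suc k))" for k
    proof -
      have "(f has_derivative blinfun_apply (fderiv f (x (n k) + t *\<^sub>R h k))) (at (x (n k) + t *\<^sub>R h k))"
        if "t \<in> {0..1}" for t
        using seg[of "\<lambda>_. t"] that by (intro has_derivative_fderiv[OF f]) (auto simp: U_bounded_def)
      then have "\<exists>t\<in>{0..1}. norm (f (x (n k) + h k) - f (x (n k)))
          \<le> norm (blinfun_apply (fderiv f (x (n k) + t *\<^sub>R h k)) (h k)) + inverse (real (Suc k))"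
        by (rule segment_value_bound) auto
      then show ?thesis by (simp add: h_def)
    qed
    then obtain t where t: "\<And>k. t k \<in> {0..1}" "\<And>k. norm (f (x (m k)) - f (x (n k)))
        \<le> norm (blinfun_apply (fderiv f (x (n k) + t k *\<^sub>R h k)) (h k)) + inverse (real (Suc k))"
      by metis
    \<comment> \<open>The positions \<open>t k\<close> are arbitrary but bounded by 1, so the points
      on the segments form a subsequence of \<open>x\<close> plus a weakly summable
      perturbation.\<close>
    have "weakly_p_summable p (\<lambda>k. t k *\<^sub>R h k)"
      using t(1) by (intro weakly_p_summable_scaleR[where C = 1] p h) auto
    then have "weakly_p_Cauchy p (\<lambda>k. x (n k) + t k *\<^sub>R h k)"
      by (intro weakly_p_Cauchy_add[OF p weakly_p_Cauchy_subseq[OF x(2) mn(2)]]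
          weakly_p_summable_imp_Cauchy[OF p])
    then have "(\<lambda>k. blinfun_apply (fderiv f (x (n k) + t k *\<^sub>R h k)) (h k)) \<longlonglongrightarrow> 0"
      using null[OF seg[of t, OF t(1)] _ h] by blast
    then have "(\<lambda>k. norm (blinfun_apply (fderiv f (x (n k) + t k *\<^sub>R h k)) (h k))
        + inverse (real (Suc k))) \<longlonglongrightarrow> 0"
      by (intro tendsto_add_zero tendsto_norm_zero LIMSEQ_inverse_real_of_nat)
    then show "(\<lambda>k. f (x (m k)) - f (x (n k))) \<longlonglongrightarrow> 0"
      by (rule Lim_null_comparison[OF always_eventually[OF allI[OF t(2)]]])
  qed
  then show "convergent (\<lambda>n. f (x n))" by (rule Cauchy_convergent)
qed

text \<open>Operators in the image are derivatives at points \<open>y k\<close> of \<open>A\<close>.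
  Precompactness extracts a weakly Cauchy subsequence of \<open>y\<close>, and \<open>h\<close>
  along the matching indices is still weakly summable.\<close>

lemma fderiv_null_imp_uniformly_p_convergent:
  fixes f :: "'a::real_normed_vector \<Rightarrow> 'b::real_normed_vector"
  assumes U: "open U"
    and null: "\<And>x h. U_bounded U (range x) \<Longrightarrow> weakly_p_Cauchy p x \<Longrightarrow> weakly_p_summable p h \<Longrightarrow>
      (\<lambda>n. blinfun_apply (fderiv f (x n)) (h n)) \<longlonglongrightarrow> 0"
    and A: "U_bounded U A" "weakly_p_precompact p A"
  shows "uniformly_p_convergent p (fderiv f ` A)"
  unfolding uniformly_p_convergent_def
proof (intro allI impI SUP_tendsto_0I)
  fix h :: "nat \<Rightarrow> 'a" and T and r :: "nat \<Rightarrow> nat"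
  assume h: "weakly_p_summable p h" and T: "\<And>k::nat. T k \<in> fderiv f ` A" and r: "strict_mono r"
  obtain y where y: "\<And>k. y k \<in> A" "\<And>k. T k = fderiv f (y k)" using T unfolding image_iff by metis
  then obtain s :: "nat \<Rightarrow> nat" where s: "strict_mono s" "weakly_p_Cauchy p (y \<circ> s)"
    using A(2) unfolding weakly_p_precompact_def by blast
  have "U_bounded U (range (y \<circ> s))" using y(1) by (intro U_bounded_subset[OF U A(1)]) auto
  moreover have "weakly_p_summable p (\<lambda>k. h (r (s k)))"
    using weakly_p_summable_subseq[OF weakly_p_summable_subseq[OF h r] s(1)] .
  ultimately have "(\<lambda>k. blinfun_apply (fderiv f ((y \<circ> s) k)) (h (r (s k)))) \<longlonglongrightarrow> 0"
    using s(2) by (intro null)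
  then have "(\<lambda>k. norm (blinfun_apply (T (s k)) (h (r (s k))))) \<longlonglongrightarrow> 0"
    by (simp add: y(2) tendsto_norm_zero)
  then show "\<exists>s. strict_mono s \<and> (\<lambda>k. norm (blinfun_apply (T (s k)) (h (r (s k))))) \<longlonglongrightarrow> 0"
    using s(1) by blast
qed

theorem theorem3p3:
  fixes p :: real and U :: "'a::banach set" and f :: "'a \<Rightarrow> 'b::banach"
  assumes "1 \<le> p" and "open U" and "convex U" and "f \<in> C1u U"
  shows
    "(f \<in> Cp_wsc p U \<longleftrightarrow>
        (\<forall>(x :: nat \<Rightarrow> 'a) (h :: nat \<Rightarrow> 'a).
           U_bounded U (range x) \<longrightarrow> weakly_p_Cauchy p x \<longrightarrow> weakly_p_Cauchy p h \<longrightarrow>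
           convergent (\<lambda>n. blinfun_apply (fderiv f (x n)) (h n)))) \<and>
     (f \<in> Cp_wsc p U \<longleftrightarrow>
        (\<forall>(x :: nat \<Rightarrow> 'a) (h :: nat \<Rightarrow> 'a).
           U_bounded U (range x) \<longrightarrow> weakly_p_Cauchy p x \<longrightarrow> weakly_p_summable p h \<longrightarrow>
           (\<lambda>n. SUP m. ennreal (norm (blinfun_apply (fderiv f (x m)) (h n)))) \<longlonglongrightarrow> 0)) \<and>
     (f \<in> Cp_wsc p U \<longleftrightarrow>
        (\<forall>(x :: nat \<Rightarrow> 'a) (h :: nat \<Rightarrow> 'a).
           U_bounded U (range x) \<longrightarrow> weakly_p_Cauchy p x \<longrightarrow> weakly_p_summable p h \<longrightarrow>
           (\<lambda>n. blinfun_apply (fderiv f (x n)) (h n)) \<longlonglongrightarrow> 0)) \<and>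
     (f \<in> Cp_wsc p U \<longleftrightarrow>
        (\<forall>A. U_bounded U A \<longrightarrow> weakly_p_precompact p A \<longrightarrow>
           uniformly_p_convergent p (fderiv f ` A)))"
    (is "(?i \<longleftrightarrow> ?ii) \<and> (?i \<longleftrightarrow> ?iii) \<and> (?i \<longleftrightarrow> ?iv) \<and> (?i \<longleftrightarrow> ?v)")
proof -
  have p: "0 < p" "0 \<le> p" using assms(1) by auto
  \<comment> \<open>Two cycles through (iv): (i), (ii), (iv), (i) and (iv), (v), (iii),
    (iv).\<close>
  have "?i \<Longrightarrow> ?ii"
    using Cp_wsc_imp_fderiv_convergent[OF p(1) assms(2,4)] by blast
  moreover have "?ii \<Longrightarrow> ?iv"
    by (intro allI impI convergent_imp_tendsto_0_summable[OF p(2)]) simp_all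
  moreover have "?iv \<Longrightarrow> ?i"
    by (rule fderiv_null_imp_Cp_wsc[OF p(2) assms(2,3,4)]) blast
  moreover have "?iv \<Longrightarrow> ?v"
    using fderiv_null_imp_uniformly_p_convergent[OF assms(2), of p f] by blast
  moreover have "?v \<Longrightarrow> ?iii"
  proof (intro allI impI)
    fix x h :: "nat \<Rightarrow> 'a"
    assume v: ?v and x: "U_bounded U (range x)" "weakly_p_Cauchy p x" and h: "weakly_p_summable p h"
    have "uniformly_p_convergent p (fderiv f ` range x)"
      using v x(1) weakly_p_precompact_range[OF x(2)] by blast
    then show "(\<lambda>n. SUP m. ennreal (norm (blinfun_apply (fderiv f (x m)) (h n)))) \<longlonglongrightarrow> 0"
      using h unfolding uniformly_p_convergent_def by (simp add: image_image)
  qed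
  moreover have "?iii \<Longrightarrow> ?iv"
  proof (intro allI impI)
    fix x h :: "nat \<Rightarrow> 'a"
    assume iii: ?iii and x: "U_bounded U (range x)" "weakly_p_Cauchy p x" and h: "weakly_p_summable p h"
    then have "(\<lambda>n. SUP m. ennreal (norm (blinfun_apply (fderiv f (x m)) (h n)))) \<longlonglongrightarrow> 0" by blast
    \<comment> \<open>The diagonal choice \<open>m = n\<close> is dominated by the supremum over
      \<open>m\<close>.\<close>
    then have "(\<lambda>n. norm (blinfun_apply (fderiv f (x n)) (h n))) \<longlonglongrightarrow> 0"
      by (rule tendsto_0_of_SUP_tendsto_0) auto
    then show "(\<lambda>n. blinfun_apply (fderiv f (x n)) (h n)) \<longlonglongrightarrow> 0"
      by (rule tendsto_norm_zero_cancel)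
  qed
  ultimately show ?thesis by argo
qed

end
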